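(* Assume: (i) there is $\epsilon>0$ such that $Q(y\mid x)\ge\epsilon$ for every $x\in\mathbb{X}$ and $y\in\mathbb{Y}$; (ii) for every $u\in\mathbb{U}$ the transition kernel $\mathcal{T}(\cdot\mid\cdot,u)$ is a mixing kernel. Let $z_0^-,z^*\in\mathcal{P}(\mathbb{X})$ and, for $t\ge0$ and $N\ge1$, $$L_t^N:=\sup_{\hat\gamma\in\hat\Gamma}E_{z_0^-}^{\hat\gamma}\Big[\big\|P^{z_t^-}(X_{t+N}\in\cdot\mid Y_{[t,t+N]},U_{[t,t+N-1]})-P^{z^*}(X_{t+N}\in\cdot\mid Y_{[t,t+N]},U_{[t,t+N-1]})\big\|_{TV}\Big].$$ Then there exist constants $r<1$ and $K$ such that, for all $t\ge0$ and $N\ge1$, $$L_t^N\le r^{N-1}K.$$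
   Context: $\mathbb{X}$ is a standard Borel space (hidden states); $\mathbb{Y}$ (observations) and $\mathbb{U}$ (actions) are finite sets; $\mathcal{P}(\mathbb{X})$ is the set of Borel probability measures on $\mathbb{X}$. $\mathcal{T}$ is a stochastic kernel from $\mathbb{X}\times\mathbb{U}$ to $\mathbb{X}$ and $Q$ a stochastic kernel from $\mathbb{X}$ to $\mathbb{Y}$. Dynamics: $X_0\sim z_0^-$; given the past, $X_{t+1}\sim\mathcal{T}(\cdot\mid X_t,U_t)$ and $Y_t\sim Q(\cdot\mid X_t)$. An admissible policy chooses $U_t$ as a measurable function of $(Y_{[0,t]},U_{[0,t-1]})$; $E^{\gamma}_{z_0^-}$ is the expectation under policy $\gamma$. Notation: $Y_{[s,t]}=(Y_s,\dots,Y_t)$, similarly for $U$. For a prior $z$ on the state at time $t$, $P^z(X_{t+k}\in\cdot\mid y_{[t,t+k]},u_{[t,t+k-1]})=:\pi_k$ is the Bayes posterior: $\pi_0(dx)\propto Q(y_t\mid x)z(dx)$ and $\pi_{k+1}(dx)\propto Q(y_{t+k+1}\mid x)\int\mathcal{T}(dx\mid x',u_{t+k})\pi_k(dx')$. The true predictor is $z_t^-(\cdot)=P^{z_0^-}(X_t\in\cdot\mid Y_{[0,t-1]},U_{[0,t-1]})$ for $t\ge1$ (with $z_0^-$ the given prior). $\hat\Gamma$ is the set of Markov control policies for the controlled window state $\hat z_n=(z_{n-N}^-,Y_{[n-N,n]},U_{[n-N,n-1]})$, $n\ge N$, i.e. policies mapping $(\hat z_n,n)$ to $U_n$; on the first $N$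 steps actions are functions of the information $(Y_{[0,n]},U_{[0,n-1]})$ available so far. $\|\mu-\nu\|_{TV}=2\sup_{B}|\mu(B)-\nu(B)|$, supremum over Borel sets. A nonnegative kernel $K$ on $\mathbb{X}$ is *mixing* if there are a constant $\varepsilon\in(0,1]$ and a nonnegative measure $\lambda$ on $\mathbb{X}$ with $\varepsilon\lambda(A)\le K(x,A)\le\frac1\varepsilon\lambda(A)$ for all $x\in\mathbb{X}$ and all Borel $A$. *)

theory Defs
  imports "HOL-Probability.Probability"
begin

definition standard_borel :: "'x measure \<Rightarrow> bool" where
  "standard_borel M \<longleftrightarrow>
     (\<exists>S. completely_metrizable_space S \<and> second_countable S \<and> topspace S = space M \<and>
          sets M = sigma_sets (topspace S) {V. openin S V})"

text \<open>The total variation norm of a difference of probability measures, normalised so that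
  mutually singular measures have distance 2.\<close>

definition tv_dist :: "'x measure \<Rightarrow> 'x measure \<Rightarrow> 'x measure \<Rightarrow> real" where
  "tv_dist M \<mu> \<nu> = 2 * (SUP B\<in>sets M. \<bar>measure \<mu> B - measure \<nu> B\<bar>)"

definition mixing_kernel :: "'x measure \<Rightarrow> ('x \<Rightarrow> 'x measure) \<Rightarrow> bool" where
  "mixing_kernel M K \<longleftrightarrow>
     (\<exists>\<epsilon>::real. \<exists>m::'x measure. 0 < \<epsilon> \<and> \<epsilon> \<le> 1 \<and> sets m = sets M \<and>
        (\<forall>x\<in>space M. \<forall>A\<in>sets M.
           ennreal \<epsilon> * emeasure m A \<le> emeasure (K x) A \<and>
           emeasure (K x) A \<le> ennreal (1 / \<epsilon>) * emeasure m A))"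

text \<open>A policy \<open>\<gamma>\<close> picks the action \<open>U\<^sub>n = \<gamma> n [Y\<^sub>0, \<dots>, Y\<^sub>n] [U\<^sub>0, \<dots>, U\<^sub>n\<^sub>-\<^sub>1]\<close>; its measurability is
  automatic since observations and actions are finite.\<close>

type_synonym ('y, 'u) policy = "nat \<Rightarrow> 'y list \<Rightarrow> 'u list \<Rightarrow> 'u"

abbreviation history_space :: "'x measure \<Rightarrow> ('x \<times> 'y list \<times> 'u list) measure" where
  "history_space M \<equiv> M \<Otimes>\<^sub>M (count_space UNIV \<Otimes>\<^sub>M count_space UNIV)"

text \<open>\<open>history_law M T Q z0 \<gamma> n\<close> is the joint law of the triple
  \<open>(X\<^sub>n, [Y\<^sub>0, \<dots>, Y\<^sub>n], [U\<^sub>0, \<dots>, U\<^sub>n\<^sub>-\<^sub>1])\<close> under the policy \<open>\<gamma>\<close> and the initial law \<open>z0\<close>.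
  Past states need not be recorded, as neither the transitions nor the policy depend on them.\<close>

primrec history_law ::
  "'x measure \<Rightarrow> ('x \<times> 'u \<Rightarrow> 'x measure) \<Rightarrow> ('x \<Rightarrow> 'y measure) \<Rightarrow> 'x measure \<Rightarrow>
   ('y, 'u) policy \<Rightarrow> nat \<Rightarrow> ('x \<times> 'y list \<times> 'u list) measure" where
  "history_law M T Q z0 \<gamma> 0 =
     z0 \<bind> (\<lambda>x. Q x \<bind> (\<lambda>y. return (history_space M) (x, [y], [])))"
| "history_law M T Q z0 \<gamma> (Suc n) =
     history_law M T Q z0 \<gamma> n \<bind> (\<lambda>(x, ys, us).
       let u = \<gamma> n ys us in
       T (x, u) \<bind> (\<lambda>x'. Q x' \<bind> (\<lambda>y'. return (history_space M) (x', ys @ [y'], us @ [u]))))"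

text \<open>The conditional law of \<open>X\<^sub>t\<close> given the event that \<open>[Y\<^sub>0, \<dots>, Y\<^sub>t\<^sub>-\<^sub>1] = ys\<close> and
  \<open>[U\<^sub>0, \<dots>, U\<^sub>t\<^sub>-\<^sub>1] = us\<close>. The conditioning variables take finitely many values, so elementary
  conditioning suffices; the value is meaningful only when this event has positive probability.
  For \<open>t = 0\<close> the event is almost sure and the value is \<open>z0\<close>.\<close>

definition predictor ::
  "'x measure \<Rightarrow> ('x \<times> 'u \<Rightarrow> 'x measure) \<Rightarrow> ('x \<Rightarrow> 'y measure) \<Rightarrow> 'x measure \<Rightarrow>
   ('y, 'u) policy \<Rightarrow> nat \<Rightarrow> 'y list \<Rightarrow> 'u list \<Rightarrow> 'x measure" where
  "predictor M T Q z0 \<gamma> t ys us =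
     distr
       (uniform_measure (history_law M T Q z0 \<gamma> t)
          {h \<in> space (history_space M). butlast (fst (snd h)) = ys \<and> snd (snd h) = us})
       M fst"

definition bayes_update :: "('x \<Rightarrow> 'y measure) \<Rightarrow> 'y \<Rightarrow> 'x measure \<Rightarrow> 'x measure" where
  "bayes_update Q y \<mu> =
     density \<mu> (\<lambda>x. emeasure (Q x) {y} / (\<integral>\<^sup>+ x'. emeasure (Q x') {y} \<partial>\<mu>))"

text \<open>\<open>posterior T Q z y u k\<close> is the law of the state at time \<open>t + k\<close> given the observations
  \<open>y 0, \<dots>, y k\<close> made at times \<open>t, \<dots>, t + k\<close> and the actions \<open>u 0, \<dots>, u (k - 1)\<close>, when the state
  at time \<open>t\<close> has prior \<open>z\<close>.\<close>

primrec posterior ::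
  "('x \<times> 'u \<Rightarrow> 'x measure) \<Rightarrow> ('x \<Rightarrow> 'y measure) \<Rightarrow> 'x measure \<Rightarrow>
   (nat \<Rightarrow> 'y) \<Rightarrow> (nat \<Rightarrow> 'u) \<Rightarrow> nat \<Rightarrow> 'x measure" where
  "posterior T Q z y u 0 = bayes_update Q (y 0) z"
| "posterior T Q z y u (Suc k) =
     bayes_update Q (y (Suc k)) (posterior T Q z y u k \<bind> (\<lambda>x. T (x, u k)))"

text \<open>Policies that from time \<open>N\<close> on are (almost surely) a measurable function \<open>g n\<close> of the window
  state consisting of the predictor at time \<open>n - N\<close>, the last \<open>N + 1\<close> observations and the last \<open>N\<close>
  actions. The reference to \<open>\<gamma>\<close> on both sides is not circular: the law of the history at time \<open>n\<close>
  and the predictor at time \<open>n - N\<close> only involve the actions before time \<open>n\<close>.\<close>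

definition window_policies ::
  "'x measure \<Rightarrow> ('x \<times> 'u \<Rightarrow> 'x measure) \<Rightarrow> ('x \<Rightarrow> 'y measure) \<Rightarrow> 'x measure \<Rightarrow> nat \<Rightarrow>
   ('y, 'u) policy set" where
  "window_policies M T Q z0 N =
     {\<gamma>. \<exists>g :: nat \<Rightarrow> 'x measure \<times> 'y list \<times> 'u list \<Rightarrow> 'u.
        \<forall>n\<ge>N. g n \<in> prob_algebra M \<Otimes>\<^sub>M (count_space UNIV \<Otimes>\<^sub>M count_space UNIV)
                  \<rightarrow>\<^sub>M count_space UNIV \<and>
          (AE (x, ys, us) in history_law M T Q z0 \<gamma> n.
             \<gamma> n ys us =
               g n (predictor M T Q z0 \<gamma> (n - N) (take (n - N) ys) (take (n - N) us),
                    drop (n - N) ys, drop (n - N) us))}"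

text \<open>The integrand is nonnegative, so the expectation and the supremum over policies are taken in
  the extended nonnegative reals, where both always exist.\<close>

definition filter_gap ::
  "'x measure \<Rightarrow> ('x \<times> 'u \<Rightarrow> 'x measure) \<Rightarrow> ('x \<Rightarrow> 'y measure) \<Rightarrow> 'x measure \<Rightarrow> 'x measure \<Rightarrow>
   nat \<Rightarrow> nat \<Rightarrow> ennreal" where
  "filter_gap M T Q z0 zs t N =
     (SUP \<gamma> \<in> window_policies M T Q z0 N.
        \<integral>\<^sup>+ (x, ys, us).
          ennreal (tv_dist M
            (posterior T Q (predictor M T Q z0 \<gamma> t (take t ys) (take t us))
               (\<lambda>i. ys ! (t + i)) (\<lambda>i. us ! (t + i)) N)
            (posterior T Q zs (\<lambda>i. ys ! (t + i)) (\<lambda>i. us ! (t + i)) N))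
        \<partial>history_law M T Q z0 \<gamma> (t + N))"

end

theory Submission
  imports Defs
begin

text \<open>
  The posterior forgets its prior at a geometric rate for every single sequence of observations and
  actions; the expectation and the supremum over policies are then harmless.

  Up to normalisation, the integral of \<open>F\<close> against the posterior after \<open>k\<close> steps is the integral of
  \<open>L\<^sub>1 (\<dots> (L\<^sub>k F))\<close> against the posterior at the first observation, where
  \<open>L\<^sub>i f x = \<integral> Q(y\<^sub>i | x') f x' T(dx' | x, u\<^sub>i\<^sub>-\<^sub>1)\<close>. The normalisation cancels in a quotient of two such
  integrals. Let \<open>a G \<le> F \<le> b G\<close> hold pointwise. If the transition kernel lies between \<open>\<epsilon> m\<close> and
  \<open>m / \<epsilon>\<close>, then \<open>L (F - a G)\<close> and \<open>L (b G - F)\<close> are both bounded from below by multiples of \<open>L G\<close>,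
  and these multiples add up to \<open>\<epsilon>\<^sup>2 (b - a)\<close>. Hence \<open>a' L G \<le> L F \<le> b' L G\<close> with
  \<open>b' - a' = (1 - \<epsilon>\<^sup>2) (b - a)\<close> (lemma \<open>ratio_oscillation_contraction\<close>). Iterating this for the
  indicator function \<open>F\<close> of a set and \<open>G = 1\<close> confines the posterior probabilities of this set, for
  all priors at once, to an interval of length \<open>(1 - \<epsilon>\<^sup>2) ^ k\<close> (lemmas \<open>posterior_ratio_sandwich\<close> and
  \<open>posterior_tv_contraction\<close>). This is the contraction of Birkhoff for positive operators, carried out
  by hand on quotients of integrals. It avoids the Hilbert metric, and the dual formulation with test
  functions avoids any comparison of the two filters along the way.

  It remains to see that the predictor is a probability measure along almost every history. It is a
  conditional law given past observations and actions, so this fails only if the past has probability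
  zero; there are countably many pasts, and almost surely none of the null ones occurs (lemma
  \<open>AE_past_event_pos\<close>). Finitely many actions allow one \<open>\<epsilon>\<close> for all of them, which gives the rate
  \<open>r = 1 - \<epsilon>\<^sup>2\<close> and the constant \<open>K = 2\<close>.
\<close>

section \<open>Bounded nonnegative test functions\<close>

text \<open>Bounded nonnegative functions are integrable against every finite measure, and their real
  integrals agree with the extended nonnegative ones. This permits subtraction, which the contraction
  argument needs, as well as the integration rule for \<open>\<bind>\<close> in the Giry monad.\<close>

definition test_fun :: "'x measure \<Rightarrow> ('x \<Rightarrow> real) \<Rightarrow> bool" where
  "test_fun M f \<longleftrightarrow> f \<in> borel_measurable M \<and> (\<exists>C. \<forall>x\<in>space M. 0 \<le> f x \<and> f x \<le> C)"

lemma test_funI: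
  assumes "f \<in> borel_measurable M" "\<And>x. x \<in> space M \<Longrightarrow> 0 \<le> f x" "\<And>x. x \<in> space M \<Longrightarrow> f x \<le> C"
  shows "test_fun M f"
  using assms unfolding test_fun_def by blast

lemma test_fun_measurable: "test_fun M f \<Longrightarrow> f \<in> borel_measurable M"
  and test_fun_nonneg: "test_fun M f \<Longrightarrow> x \<in> space M \<Longrightarrow> 0 \<le> f x"
  by (auto simp: test_fun_def)

lemma test_fun_mult:
  assumes "test_fun M f" "test_fun M g"
  shows "test_fun M (\<lambda>x. f x * g x)"
proof -
  obtain C where C: "\<forall>x\<in>space M. 0 \<le> f x \<and> f x \<le> C"
    using assms(1) by (auto simp: test_fun_def)
  obtain D where D: "\<forall>x\<in>space M. 0 \<le> g x \<and> g x \<le> D"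
    using assms(2) by (auto simp: test_fun_def)
  show ?thesis
  proof (rule test_funI)
    show "(\<lambda>x. f x * g x) \<in> borel_measurable M"
      using assms by (intro borel_measurable_times test_fun_measurable)
    show "f x * g x \<le> C * D" if "x \<in> space M" for x
      using C D that by (intro mult_mono) force+
  qed (use C D in auto)
qed

text \<open>The coefficients may be negative: the contraction argument applies this to \<open>F - a G\<close> and
  \<open>b G - F\<close>.\<close>

lemma test_fun_linear:
  assumes "test_fun M f" "test_fun M g" "\<And>x. x \<in> space M \<Longrightarrow> 0 \<le> a * f x + b * g x"
  shows "test_fun M (\<lambda>x. a * f x + b * g x)"
proof -
  obtain C where C: "\<forall>x\<in>space M. 0 \<le> f x \<and> f x \<le> C"
    using assms(1) by (auto simp: test_fun_def)
  obtain D where D: "\<forall>x\<in>space M. 0 \<le> g x \<and> g x \<le> D"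
    using assms(2) by (auto simp: test_fun_def)
  show ?thesis
  proof (rule test_funI)
    show "(\<lambda>x. a * f x + b * g x) \<in> borel_measurable M"
      using assms(1,2)[THEN test_fun_measurable] by measurable
    show "a * f x + b * g x \<le> \<bar>a\<bar> * C + \<bar>b\<bar> * D" if "x \<in> space M" for x
    proof -
      have "a * f x \<le> \<bar>a\<bar> * f x" "b * g x \<le> \<bar>b\<bar> * g x"
        using C D that by (auto intro!: mult_right_mono)
      moreover have "\<bar>a\<bar> * f x \<le> \<bar>a\<bar> * C" "\<bar>b\<bar> * g x \<le> \<bar>b\<bar> * D"
        using C D that by (auto intro!: mult_left_mono)
      ultimately show ?thesis by linarith
    qed
  qed (use assms in auto)
qed

lemma test_fun_integrable:
  assumes "finite_measure \<mu>" "sets \<mu> = sets M" "test_fun M f"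
  shows "integrable \<mu> f"
proof -
  interpret finite_measure \<mu> by fact
  obtain C where C: "\<forall>x\<in>space M. 0 \<le> f x \<and> f x \<le> C"
    using assms(3) by (auto simp: test_fun_def)
  have "f \<in> borel_measurable \<mu>"
    using test_fun_measurable[OF assms(3)] measurable_cong_sets[OF assms(2) refl] by blast
  moreover have "AE x in \<mu>. norm (f x) \<le> C"
    using C sets_eq_imp_space_eq[OF assms(2)] by (intro AE_I2) auto
  ultimately show ?thesis by (intro integrable_const_bound)
qed

lemma test_fun_integral_nonneg:
  assumes "sets \<mu> = sets M" "test_fun M f"
  shows "0 \<le> integral\<^sup>L \<mu> f"
  using assms sets_eq_imp_space_eq[OF assms(1)]
  by (intro integral_nonneg_AE AE_I2) (auto simp: test_fun_nonneg)

lemma test_fun_nn_integral: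
  assumes "finite_measure \<mu>" "sets \<mu> = sets M" "test_fun M f"
  shows "(\<integral>\<^sup>+x. ennreal (f x) \<partial>\<mu>) = ennreal (integral\<^sup>L \<mu> f)"
  using assms sets_eq_imp_space_eq[OF assms(2)]
  by (intro nn_integral_eq_integral test_fun_integrable AE_I2) (auto simp: test_fun_nonneg)

lemma prob_kernelD:
  assumes "K \<in> M \<rightarrow>\<^sub>M prob_algebra N" "x \<in> space M"
  shows "prob_space (K x)" "finite_measure (K x)" "sets (K x) = sets N" "space (K x) = space N"
proof -
  have "K x \<in> space (prob_algebra N)" using assms by (rule measurable_space)
  then show "prob_space (K x)" "sets (K x) = sets N" by (auto simp: space_prob_algebra)
  then show "finite_measure (K x)" "space (K x) = space N"
    using sets_eq_imp_space_eq by (auto simp: prob_space_def)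
qed

lemma test_fun_kernel_integral:
  assumes K: "K \<in> M \<rightarrow>\<^sub>M prob_algebra N" and f: "test_fun N f"
  shows "test_fun M (\<lambda>x. integral\<^sup>L (K x) f)"
proof -
  obtain C where C: "\<forall>x\<in>space N. 0 \<le> f x \<and> f x \<le> C"
    using f by (auto simp: test_fun_def)
  show ?thesis
  proof (rule test_funI)
    show "(\<lambda>x. integral\<^sup>L (K x) f) \<in> borel_measurable M"
      using measurable_compose[OF measurable_prob_algebraD[OF K]
          integral_measurable_subprob_algebra[OF test_fun_measurable[OF f]]] .
    fix x assume x: "x \<in> space M"
    note Kx = prob_kernelD[OF K x]
    show "0 \<le> integral\<^sup>L (K x) f" by (rule test_fun_integral_nonneg[OF Kx(3) f])
    show "integral\<^sup>L (K x) f \<le> C"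
      using C Kx by (intro prob_space.integral_le_const test_fun_integrable[OF _ Kx(3) f] AE_I2) auto
  qed
qed

lemma prob_bind:
  assumes \<mu>: "\<mu> \<in> space (prob_algebra M)" and K: "K \<in> M \<rightarrow>\<^sub>M prob_algebra N"
  shows "\<mu> \<bind> K \<in> space (prob_algebra N)"
  using measurable_bind_prob_space[OF measurable_const[OF \<mu>] K, THEN measurable_space,
      of undefined "count_space UNIV"] by simp

lemma prob_algebraD:
  assumes "\<mu> \<in> space (prob_algebra M)"
  shows "prob_space \<mu>" "finite_measure \<mu>" "sets \<mu> = sets M" "space \<mu> = space M"
  using assms sets_eq_imp_space_eq[of \<mu> M] by (auto simp: space_prob_algebra prob_space_def)

lemma test_fun_integral_bind:
  assumes \<mu>: "\<mu> \<in> space (prob_algebra M)" and K: "K \<in> M \<rightarrow>\<^sub>M prob_algebra N" and f: "test_fun N f"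
  shows "integral\<^sup>L (\<mu> \<bind> K) f = (\<integral>x. integral\<^sup>L (K x) f \<partial>\<mu>)"
proof -
  note \<mu>' = prob_algebraD[OF \<mu>]
  note b = prob_algebraD[OF prob_bind[OF \<mu> K]]
  have K': "K \<in> \<mu> \<rightarrow>\<^sub>M subprob_algebra N"
    using measurable_prob_algebraD[OF K] measurable_cong_sets[OF \<mu>'(3) refl] by blast
  have f': "(\<lambda>x. ennreal (f x)) \<in> borel_measurable N"
    using test_fun_measurable[OF f] by simp
  have "ennreal (integral\<^sup>L (\<mu> \<bind> K) f) = (\<integral>\<^sup>+x. f x \<partial>(\<mu> \<bind> K))"
    by (rule test_fun_nn_integral[OF b(2,3) f, symmetric])
  also have "\<dots> = (\<integral>\<^sup>+x. \<integral>\<^sup>+y. f y \<partial>K x \<partial>\<mu>)"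
    by (rule nn_integral_bind[OF f' K'])
  also have "\<dots> = (\<integral>\<^sup>+x. ennreal (integral\<^sup>L (K x) f) \<partial>\<mu>)"
    using \<mu>' f by (intro nn_integral_cong test_fun_nn_integral) (auto simp: prob_kernelD[OF K])
  also have "\<dots> = ennreal (\<integral>x. integral\<^sup>L (K x) f \<partial>\<mu>)"
    by (rule test_fun_nn_integral[OF \<mu>'(2,3) test_fun_kernel_integral[OF K f]])
  finally show ?thesis
    using test_fun_integral_nonneg[OF b(3) f]
      test_fun_integral_nonneg[OF \<mu>'(3) test_fun_kernel_integral[OF K f]]
    by simp
qed

section \<open>Contraction by one mixing step\<close>

text \<open>The mixing condition with its constant and reference measure exposed, so that the constant can
  be decreased to one that serves several kernels.\<close>

definition dominated_kernel :: "'x measure \<Rightarrow> real \<Rightarrow> 'x measure \<Rightarrow> ('x \<Rightarrow> 'x measure) \<Rightarrow> bool" where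
  "dominated_kernel M \<epsilon> m K \<longleftrightarrow> sets m = sets M \<and>
     (\<forall>x\<in>space M. \<forall>A\<in>sets M. ennreal \<epsilon> * emeasure m A \<le> emeasure (K x) A \<and>
        emeasure (K x) A \<le> ennreal (1 / \<epsilon>) * emeasure m A)"

lemma dominated_kernel_mono:
  assumes "dominated_kernel M \<epsilon> m K" "0 < \<delta>" "\<delta> \<le> \<epsilon>"
  shows "dominated_kernel M \<delta> m K"
proof -
  have "ennreal \<delta> * e \<le> ennreal \<epsilon> * e" "ennreal (1 / \<epsilon>) * e \<le> ennreal (1 / \<delta>) * e" for e
    using assms(2,3) by (auto intro!: mult_right_mono ennreal_leI frac_le)
  then show ?thesis
    using assms(1) unfolding dominated_kernel_def by (meson order_trans)
qed

text \<open>The comparison of measures passes to integrals. The reference measure is finite, since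
  \<open>\<epsilon> m\<close> lies below a probability measure.\<close>

lemma dominated_kernel_integral:
  assumes K: "K \<in> M \<rightarrow>\<^sub>M prob_algebra M" and D: "dominated_kernel M \<epsilon> m K" and \<epsilon>: "0 < \<epsilon>"
    and x: "x \<in> space M" and f: "test_fun M f"
  shows "\<epsilon> * integral\<^sup>L m f \<le> integral\<^sup>L (K x) f" "integral\<^sup>L (K x) f \<le> 1 / \<epsilon> * integral\<^sup>L m f"
    and "finite_measure m"
proof -
  note Kx = prob_kernelD[OF K x]
  have m: "sets m = sets M" using D by (simp add: dominated_kernel_def)
  have "ennreal \<epsilon> * emeasure m (space m) \<le> emeasure (K x) (space m)"
    using D x m by (metis dominated_kernel_def sets.top)
  also have "\<dots> \<le> 1"
    using Kx(1) by (simp add: prob_space_imp_subprob_space subprob_space.subprob_emeasure_le_1)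
  finally have "ennreal \<epsilon> * emeasure m (space m) \<noteq> \<top>" by (auto simp: top_unique)
  then have "emeasure m (space m) \<noteq> \<infinity>"
    using \<epsilon> by (auto simp: ennreal_mult_eq_top_iff)
  then show fm: "finite_measure m" by (rule finite_measureI)
  have f': "(\<lambda>x. ennreal (f x)) \<in> borel_measurable m"
    using measurable_compose[OF test_fun_measurable[OF f] measurable_ennreal]
      measurable_cong_sets[OF m refl] by blast
  have le1: "scale_measure (ennreal \<epsilon>) m \<le> K x"
    using D x Kx m by (subst le_measure) (auto simp: dominated_kernel_def)
  have le2: "K x \<le> scale_measure (ennreal (1 / \<epsilon>)) m"
    using D x Kx m by (subst le_measure) (auto simp: dominated_kernel_def)
  have I: "ennreal (integral\<^sup>L m f) = (\<integral>\<^sup>+x. f x \<partial>m)"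
    by (rule test_fun_nn_integral[OF fm m f, symmetric])
  have J: "ennreal (integral\<^sup>L (K x) f) = (\<integral>\<^sup>+x. f x \<partial>K x)"
    by (rule test_fun_nn_integral[OF Kx(2,3) f, symmetric])
  have nn: "0 \<le> integral\<^sup>L m f" "0 \<le> integral\<^sup>L (K x) f"
    using test_fun_integral_nonneg[OF m f] test_fun_integral_nonneg[OF Kx(3) f] .
  have "ennreal (\<epsilon> * integral\<^sup>L m f) = (\<integral>\<^sup>+x. f x \<partial>scale_measure (ennreal \<epsilon>) m)"
    using \<epsilon> nn by (simp add: nn_integral_scale_measure[OF f'] ennreal_mult I)
  also have "\<dots> \<le> ennreal (integral\<^sup>L (K x) f)"
    unfolding J using le1 m Kx by (intro nn_integral_mono_measure) auto
  finally show "\<epsilon> * integral\<^sup>L m f \<le> integral\<^sup>L (K x) f" using nn by (simp)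
  have "ennreal (integral\<^sup>L (K x) f) \<le> (\<integral>\<^sup>+x. f x \<partial>scale_measure (ennreal (1 / \<epsilon>)) m)"
    unfolding J using le2 m Kx by (intro nn_integral_mono_measure) auto
  also have "\<dots> = ennreal (1 / \<epsilon> * integral\<^sup>L m f)"
    using \<epsilon> nn by (simp only: nn_integral_scale_measure[OF f'] ennreal_mult I divide_nonneg_pos zero_le_one)
  finally show "integral\<^sup>L (K x) f \<le> 1 / \<epsilon> * integral\<^sup>L m f"
    using nn \<epsilon> by (simp)
qed

text \<open>Write \<open>L f x\<close> for the integral of \<open>g f\<close> against \<open>K x\<close> and \<open>S\<close> for the integral of \<open>g G\<close>
  against \<open>m\<close>. For every \<open>p \<ge> 0\<close>, mixing gives \<open>L p \<ge> \<epsilon> (\<integral> g p dm)\<close> and \<open>L G \<le> S / \<epsilon>\<close>, so that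
  \<open>L p \<ge> \<epsilon>\<^sup>2 (\<integral> g p dm / S) L G\<close>. With \<open>p = F - a G\<close> this raises the lower bound \<open>a\<close>, with
  \<open>p = b G - F\<close> it lowers the upper bound \<open>b\<close>, and the two gains add up to \<open>\<epsilon>\<^sup>2 (b - a)\<close> because
  these two functions add up to \<open>(b - a) G\<close>.\<close>

lemma ratio_oscillation_contraction:
  assumes K: "K \<in> M \<rightarrow>\<^sub>M prob_algebra M" and D: "dominated_kernel M \<epsilon> m K" and \<epsilon>: "0 < \<epsilon>"
    and g: "test_fun M g" and F: "test_fun M F" and G: "test_fun M G"
    and FG: "\<And>x. x \<in> space M \<Longrightarrow> a * G x \<le> F x \<and> F x \<le> b * G x"
  shows "\<exists>a' b'. b' - a' = (1 - \<epsilon>\<^sup>2) * (b - a) \<and>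
     (\<forall>x\<in>space M. a' * (\<integral>x'. g x' * G x' \<partial>K x) \<le> (\<integral>x'. g x' * F x' \<partial>K x) \<and>
                  (\<integral>x'. g x' * F x' \<partial>K x) \<le> b' * (\<integral>x'. g x' * G x' \<partial>K x))"
proof (cases "space M = {}")
  case True
  then show ?thesis by (intro exI[of _ 0] exI[of _ "(1 - \<epsilon>\<^sup>2) * (b - a)"]) auto
next
  case False
  define p where "p x = 1 * F x + (- a) * G x" for x
  define q where "q x = b * G x + (- 1) * F x" for x
  have p: "test_fun M p" unfolding p_def using F G FG by (intro test_fun_linear) auto
  have q: "test_fun M q" unfolding q_def using F G FG by (intro test_fun_linear) auto
  note tf = test_fun_mult[OF g F] test_fun_mult[OF g G] test_fun_mult[OF g p] test_fun_mult[OF g q]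
  note dom = dominated_kernel_integral[OF K D \<epsilon>]
  have m: "sets m = sets M" "finite_measure m"
    using D dom(3)[OF _ F] False by (auto simp: dominated_kernel_def)
  have lin: "(\<integral>x'. g x' * p x' \<partial>\<mu>) = (\<integral>x'. g x' * F x' \<partial>\<mu>) - a * (\<integral>x'. g x' * G x' \<partial>\<mu>)"
      "(\<integral>x'. g x' * q x' \<partial>\<mu>) = b * (\<integral>x'. g x' * G x' \<partial>\<mu>) - (\<integral>x'. g x' * F x' \<partial>\<mu>)"
    if "finite_measure \<mu>" "sets \<mu> = sets M" for \<mu>
  proof -
    note i = test_fun_integrable[OF that tf(1)] test_fun_integrable[OF that tf(2)]
    have "(\<integral>x'. g x' * p x' \<partial>\<mu>) = (\<integral>x'. g x' * F x' - a * (g x' * G x') \<partial>\<mu>)"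
      by (intro Bochner_Integration.integral_cong refl) (simp add: p_def algebra_simps)
    then show "(\<integral>x'. g x' * p x' \<partial>\<mu>) = (\<integral>x'. g x' * F x' \<partial>\<mu>) - a * (\<integral>x'. g x' * G x' \<partial>\<mu>)"
      using i by simp
    have "(\<integral>x'. g x' * q x' \<partial>\<mu>) = (\<integral>x'. b * (g x' * G x') - g x' * F x' \<partial>\<mu>)"
      by (intro Bochner_Integration.integral_cong refl) (simp add: q_def algebra_simps)
    then show "(\<integral>x'. g x' * q x' \<partial>\<mu>) = b * (\<integral>x'. g x' * G x' \<partial>\<mu>) - (\<integral>x'. g x' * F x' \<partial>\<mu>)"
      using i by simp
  qed
  define S where "S = (\<integral>x'. g x' * G x' \<partial>m)"
  define A where "A = (\<integral>x'. g x' * p x' \<partial>m)"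
  define B where "B = (\<integral>x'. g x' * q x' \<partial>m)"
  have nn: "0 \<le> S" "0 \<le> A" "0 \<le> B"
    unfolding S_def A_def B_def by (rule test_fun_integral_nonneg[OF m(1)], rule tf)+
  have AB: "A + B = (b - a) * S"
    using lin[OF m(2,1)] by (simp add: A_def B_def S_def algebra_simps)
  \<comment> \<open>The share of the gain that goes to the lower bound. If \<open>S = 0\<close>, all integrals to be compared
    vanish, and the value \<open>A / 0 = 0\<close> is as good as any.\<close>
  define \<rho> where "\<rho> = A / S"
  have low: "\<epsilon>\<^sup>2 * (V / S) * L \<le> W"
    if "\<epsilon> * V \<le> W" "L \<le> 1 / \<epsilon> * S" "0 \<le> V" "S \<noteq> 0" for V L W
  proof -
    have "\<epsilon>\<^sup>2 * (V / S) * L \<le> \<epsilon>\<^sup>2 * (V / S) * (1 / \<epsilon> * S)"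
      using that nn by (intro mult_left_mono) auto
    also have "\<dots> = \<epsilon> * V" using that \<epsilon> by (simp add: power2_eq_square)
    finally show ?thesis using that by simp
  qed
  show ?thesis
  proof (intro exI conjI ballI)
    show "(b - \<epsilon>\<^sup>2 * (b - a - \<rho>)) - (a + \<epsilon>\<^sup>2 * \<rho>) = (1 - \<epsilon>\<^sup>2) * (b - a)"
      by (simp add: algebra_simps)
    fix x assume x: "x \<in> space M"
    note Kx = prob_kernelD[OF K x]
    define LF where "LF = (\<integral>x'. g x' * F x' \<partial>K x)"
    define LG where "LG = (\<integral>x'. g x' * G x' \<partial>K x)"
    have P: "\<epsilon> * A \<le> LF - a * LG" and Q: "\<epsilon> * B \<le> b * LG - LF"
      using dom(1)[OF x tf(3)] dom(1)[OF x tf(4)] lin[OF Kx(2,3)]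
      by (auto simp: A_def B_def LF_def LG_def)
    have LG: "LG \<le> 1 / \<epsilon> * S" "0 \<le> LG"
      using dom(2)[OF x tf(2)] test_fun_integral_nonneg[OF Kx(3) tf(2)]
      by (auto simp: S_def LG_def)
    have "(a + \<epsilon>\<^sup>2 * \<rho>) * LG \<le> LF \<and> LF \<le> (b - \<epsilon>\<^sup>2 * (b - a - \<rho>)) * LG"
    proof (cases "S = 0")
      case True
      then have "LG = 0" using LG by simp
      moreover have "0 \<le> \<epsilon> * A" "0 \<le> \<epsilon> * B" using nn \<epsilon> by simp_all
      ultimately show ?thesis using P Q by simp
    next
      case False
      have B: "B / S = b - a - \<rho>" using AB False by (simp add: \<rho>_def field_simps)
      have "\<epsilon>\<^sup>2 * \<rho> * LG \<le> LF - a * LG" "\<epsilon>\<^sup>2 * (b - a - \<rho>) * LG \<le> b * LG - LF"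
        using low[OF P LG(1) nn(2) False] low[OF Q LG(1) nn(3) False] by (simp_all only: B \<rho>_def)
      then show ?thesis by (simp add: distrib_right left_diff_distrib)
    qed
    then show "(a + \<epsilon>\<^sup>2 * \<rho>) * (\<integral>x'. g x' * G x' \<partial>K x) \<le> (\<integral>x'. g x' * F x' \<partial>K x)"
      "(\<integral>x'. g x' * F x' \<partial>K x) \<le> (b - \<epsilon>\<^sup>2 * (b - a - \<rho>)) * (\<integral>x'. g x' * G x' \<partial>K x)"
      by (auto simp: LF_def LG_def)
  qed
qed

section \<open>Stability of the posterior\<close>

text \<open>Positive likelihoods make every normalisation constant of the Bayes updates positive.\<close>

locale positive_filter =
  fixes M :: "'x measure"
    and T :: "'x \<times> 'u::finite \<Rightarrow> 'x measure"
    and Q :: "'x \<Rightarrow> 'y::finite measure"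
  assumes T_kernel: "T \<in> M \<Otimes>\<^sub>M count_space UNIV \<rightarrow>\<^sub>M prob_algebra M"
    and Q_kernel: "Q \<in> M \<rightarrow>\<^sub>M prob_algebra (count_space UNIV)"
    and Q_pos: "\<And>x y. x \<in> space M \<Longrightarrow> 0 < measure (Q x) {y}"
begin

lemma T_action_kernel: "(\<lambda>x. T (x, u)) \<in> M \<rightarrow>\<^sub>M prob_algebra M"
  using T_kernel by measurable

lemma likelihood_test_fun: "test_fun M (\<lambda>x. measure (Q x) {y})"
proof (rule test_funI)
  show "(\<lambda>x. measure (Q x) {y}) \<in> borel_measurable M"
    using measurable_compose[OF Q_kernel measurable_measure_prob_algebra] by simp
qed (auto intro: prob_space.prob_le_1 prob_kernelD[OF Q_kernel])

lemma likelihood_integral_pos: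
  assumes "\<mu> \<in> space (prob_algebra M)"
  shows "0 < (\<integral>x. measure (Q x) {y} \<partial>\<mu>)"
proof -
  note \<mu> = prob_algebraD[OF assms]
  interpret prob_space \<mu> by fact
  have "(\<integral>x. measure (Q x) {y} \<partial>\<mu>) \<noteq> 0"
  proof
    assume "(\<integral>x. measure (Q x) {y} \<partial>\<mu>) = 0"
    then have "AE x in \<mu>. measure (Q x) {y} = 0"
      using test_fun_integrable[OF \<mu>(2,3) likelihood_test_fun]
      by (subst (asm) integral_nonneg_eq_0_iff_AE) auto
    moreover have "AE x in \<mu>. measure (Q x) {y} \<noteq> 0"
      using Q_pos \<mu>(4) by (intro AE_I2) (metis less_irrefl)
    ultimately have "AE x in \<mu>. False" by eventually_elim auto
    then show False by simp
  qed
  then show ?thesis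
    using test_fun_integral_nonneg[OF \<mu>(3) likelihood_test_fun, of y] by linarith
qed

lemma
  assumes "\<mu> \<in> space (prob_algebra M)"
  shows bayes_update_prob: "bayes_update Q y \<mu> \<in> space (prob_algebra M)"
    and bayes_update_integral: "test_fun M f \<Longrightarrow>
      integral\<^sup>L (bayes_update Q y \<mu>) f =
        (\<integral>x. measure (Q x) {y} * f x \<partial>\<mu>) / (\<integral>x. measure (Q x) {y} \<partial>\<mu>)"
proof -
  note \<mu> = prob_algebraD[OF assms]
  define c where "c = (\<integral>x. measure (Q x) {y} \<partial>\<mu>)"
  have c: "0 < c" using likelihood_integral_pos[OF assms] by (simp add: c_def)
  have em: "emeasure (Q x) {y} = ennreal (measure (Q x) {y})" if "x \<in> space \<mu>" for x
    using prob_kernelD(2)[OF Q_kernel, of x] that \<mu> by (simp add: finite_measure.emeasure_eq_measure)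
  have meas: "(\<lambda>x. measure (Q x) {y}) \<in> borel_measurable \<mu>"
    using test_fun_measurable[OF likelihood_test_fun] measurable_cong_sets[OF \<mu>(3) refl] by blast
  have "(\<integral>\<^sup>+x. emeasure (Q x) {y} \<partial>\<mu>) = (\<integral>\<^sup>+x. ennreal (measure (Q x) {y}) \<partial>\<mu>)"
    by (intro nn_integral_cong em)
  also have "\<dots> = ennreal c"
    unfolding c_def by (rule test_fun_nn_integral[OF \<mu>(2,3) likelihood_test_fun])
  finally have nn: "(\<integral>\<^sup>+x. emeasure (Q x) {y} \<partial>\<mu>) = ennreal c" .
  have em': "emeasure (Q x) {y} / ennreal c = ennreal (measure (Q x) {y} / c)" if "x \<in> space \<mu>" for x
    using em[OF that] c by (simp add: divide_ennreal)
  have "bayes_update Q y \<mu> = density \<mu> (\<lambda>x. ennreal (measure (Q x) {y} / c))"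
    unfolding bayes_update_def nn using meas em em'
    by (intro density_cong AE_I2) (auto cong: measurable_cong)
  note bu = this
  have "emeasure (bayes_update Q y \<mu>) (space (bayes_update Q y \<mu>)) =
      (\<integral>\<^sup>+x. ennreal (measure (Q x) {y} / c) \<partial>\<mu>)"
    unfolding bu using meas by (auto simp: emeasure_density intro!: nn_integral_cong)
  also have "\<dots> = (\<integral>\<^sup>+x. emeasure (Q x) {y} / ennreal c \<partial>\<mu>)"
    by (intro nn_integral_cong em'[symmetric])
  also have "\<dots> = (\<integral>\<^sup>+x. emeasure (Q x) {y} \<partial>\<mu>) / ennreal c"
    using meas em by (intro nn_integral_divide) (auto cong: measurable_cong)
  also have "\<dots> = 1" unfolding nn using c by (simp add: divide_ennreal)
  finally show "bayes_update Q y \<mu> \<in> space (prob_algebra M)"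
    using \<mu>(3) by (auto simp: space_prob_algebra bu intro!: prob_spaceI)
  assume f: "test_fun M f"
  have f': "f \<in> borel_measurable \<mu>"
    using test_fun_measurable[OF f] measurable_cong_sets[OF \<mu>(3) refl] by blast
  have "integral\<^sup>L (bayes_update Q y \<mu>) f = (\<integral>x. (measure (Q x) {y} / c) *\<^sub>R f x \<partial>\<mu>)"
    unfolding bu using f' meas c by (intro integral_density) auto
  also have "\<dots> = (\<integral>x. measure (Q x) {y} * f x / c \<partial>\<mu>)" by simp
  also have "\<dots> = (\<integral>x. measure (Q x) {y} * f x \<partial>\<mu>) / c" by simp
  finally show "integral\<^sup>L (bayes_update Q y \<mu>) f =
        (\<integral>x. measure (Q x) {y} * f x \<partial>\<mu>) / (\<integral>x. measure (Q x) {y} \<partial>\<mu>)"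
    by (simp add: c_def)
qed

lemma posterior_prob:
  assumes "z \<in> space (prob_algebra M)"
  shows "posterior T Q z y u k \<in> space (prob_algebra M)"
  by (induction k) (auto intro!: bayes_update_prob prob_bind[OF _ T_action_kernel] assms)

text \<open>The induction on \<open>k\<close> removes the last step of the filter and replaces \<open>F\<close> and \<open>G\<close> by their
  images under the backward operator of this step; therefore the two functions and the bounds vary
  in the induction. The new bounds \<open>a'\<close> and \<open>b'\<close> depend on the data but not on the prior \<open>z\<close>, which is
  what makes two priors comparable.\<close>

lemma posterior_ratio_sandwich:
  assumes \<epsilon>: "0 < \<epsilon>" and D: "\<And>u. dominated_kernel M \<epsilon> (m u) (\<lambda>x. T (x, u))"
    and "test_fun M F" "test_fun M G"
    and "\<And>x. x \<in> space M \<Longrightarrow> a * G x \<le> F x \<and> F x \<le> b * G x"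
  shows "\<exists>a' b'. b' - a' = (1 - \<epsilon>\<^sup>2) ^ k * (b - a) \<and>
    (\<forall>z\<in>space (prob_algebra M).
       a' * integral\<^sup>L (posterior T Q z y u k) G \<le> integral\<^sup>L (posterior T Q z y u k) F \<and>
       integral\<^sup>L (posterior T Q z y u k) F \<le> b' * integral\<^sup>L (posterior T Q z y u k) G)"
  using assms(3-5)
proof (induction k arbitrary: F G a b)
  case 0
  note F = \<open>test_fun M F\<close> and G = \<open>test_fun M G\<close>
  have "a * integral\<^sup>L \<mu> G \<le> integral\<^sup>L \<mu> F \<and> integral\<^sup>L \<mu> F \<le> b * integral\<^sup>L \<mu> G"
    if "\<mu> \<in> space (prob_algebra M)" for \<mu>
  proof -
    note \<mu> = prob_algebraD[OF that]
    note i = test_fun_integrable[OF \<mu>(2,3) F] test_fun_integrable[OF \<mu>(2,3) G]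
    have "(\<integral>x. a * G x \<partial>\<mu>) \<le> integral\<^sup>L \<mu> F" "integral\<^sup>L \<mu> F \<le> (\<integral>x. b * G x \<partial>\<mu>)"
      using 0 i \<mu>(4) by (intro integral_mono; simp)+
    then show ?thesis by simp
  qed
  then show ?case by (intro exI[of _ a] exI[of _ b]) (simp add: posterior_prob del: posterior.simps)
next
  case (Suc k)
  note F = \<open>test_fun M F\<close> and G = \<open>test_fun M G\<close>
  define g where "g x = measure (Q x) {y (Suc k)}" for x
  define K where "K x = T (x, u k)" for x
  have K: "K \<in> M \<rightarrow>\<^sub>M prob_algebra M" and DK: "dominated_kernel M \<epsilon> (m (u k)) K"
    using T_action_kernel D by (auto simp: K_def[abs_def])
  have g: "test_fun M g" unfolding g_def[abs_def] by (rule likelihood_test_fun)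
  define L where "L f x = (\<integral>x'. g x' * f x' \<partial>K x)" for f x
  have Ltf: "test_fun M (L f)" if "test_fun M f" for f
    unfolding L_def[abs_def] by (intro test_fun_kernel_integral[OF K] test_fun_mult g that)
  obtain a1 b1 where 1: "b1 - a1 = (1 - \<epsilon>\<^sup>2) * (b - a)"
      "\<And>x. x \<in> space M \<Longrightarrow> a1 * L G x \<le> L F x \<and> L F x \<le> b1 * L G x"
    using ratio_oscillation_contraction[OF K DK \<epsilon> g F G Suc.prems(3)] unfolding L_def by blast
  obtain a' b' where 2: "b' - a' = (1 - \<epsilon>\<^sup>2) ^ k * (b1 - a1)"
      "\<forall>z\<in>space (prob_algebra M).
       a' * integral\<^sup>L (posterior T Q z y u k) (L G) \<le> integral\<^sup>L (posterior T Q z y u k) (L F) \<and>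
       integral\<^sup>L (posterior T Q z y u k) (L F) \<le> b' * integral\<^sup>L (posterior T Q z y u k) (L G)"
    using Suc.IH[OF Ltf[OF F] Ltf[OF G] 1(2)] by blast
  show ?case
  proof (intro exI conjI ballI)
    show "b' - a' = (1 - \<epsilon>\<^sup>2) ^ Suc k * (b - a)" using 1(1) 2(1) by simp
    fix z assume z: "z \<in> space (prob_algebra M)"
    define \<pi> where "\<pi> = posterior T Q z y u k"
    have \<pi>: "\<pi> \<in> space (prob_algebra M)" using posterior_prob[OF z] by (simp add: \<pi>_def)
    note b = prob_bind[OF \<pi> K]
    define c where "c = (\<integral>x. g x \<partial>(\<pi> \<bind> K))"
    have c: "0 < c" using likelihood_integral_pos[OF b] by (simp add: c_def g_def)
    \<comment> \<open>The constant \<open>c\<close> does not depend on \<open>f\<close>, so it drops out of the comparison of \<open>F\<close> with \<open>G\<close>.\<close>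
    have post: "integral\<^sup>L (posterior T Q z y u (Suc k)) f = integral\<^sup>L \<pi> (L f) / c"
      if f: "test_fun M f" for f
    proof -
      have "posterior T Q z y u (Suc k) = bayes_update Q (y (Suc k)) (\<pi> \<bind> K)"
        by (simp add: \<pi>_def K_def[abs_def])
      then have "integral\<^sup>L (posterior T Q z y u (Suc k)) f = (\<integral>x. g x * f x \<partial>(\<pi> \<bind> K)) / c"
        using bayes_update_integral[OF b f] by (simp add: c_def g_def)
      then show ?thesis
        using test_fun_integral_bind[OF \<pi> K test_fun_mult[OF g f]] by (simp add: L_def[abs_def])
    qed
    have s: "a' * integral\<^sup>L \<pi> (L G) \<le> integral\<^sup>L \<pi> (L F)" "integral\<^sup>L \<pi> (L F) \<le> b' * integral\<^sup>L \<pi> (L G)"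
      using 2(2) z by (auto simp: \<pi>_def)
    show "a' * integral\<^sup>L (posterior T Q z y u (Suc k)) G \<le> integral\<^sup>L (posterior T Q z y u (Suc k)) F"
      "integral\<^sup>L (posterior T Q z y u (Suc k)) F \<le> b' * integral\<^sup>L (posterior T Q z y u (Suc k)) G"
      unfolding post[OF F] post[OF G] using s c by (auto simp: divide_right_mono)
  qed
qed

lemma posterior_tv_contraction:
  assumes \<epsilon>: "0 < \<epsilon>" and D: "\<And>u. dominated_kernel M \<epsilon> (m u) (\<lambda>x. T (x, u))"
    and z: "z \<in> space (prob_algebra M)" and z': "z' \<in> space (prob_algebra M)"
  shows "tv_dist M (posterior T Q z y u k) (posterior T Q z' y u k) \<le> 2 * (1 - \<epsilon>\<^sup>2) ^ k"
proof -
  have "\<bar>measure (posterior T Q z y u k) B - measure (posterior T Q z' y u k) B\<bar> \<le> (1 - \<epsilon>\<^sup>2) ^ k"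
    if B: "B \<in> sets M" for B
  proof -
    have "test_fun M (indicator B :: 'x \<Rightarrow> real)" "test_fun M (\<lambda>_. 1)"
      using B by (auto intro!: test_funI[where C=1] simp: indicator_def)
    then obtain a b where ab: "b - a = (1 - \<epsilon>\<^sup>2) ^ k"
      "\<And>z. z \<in> space (prob_algebra M) \<Longrightarrow>
       a * integral\<^sup>L (posterior T Q z y u k) (\<lambda>_. 1) \<le> integral\<^sup>L (posterior T Q z y u k) (indicator B) \<and>
       integral\<^sup>L (posterior T Q z y u k) (indicator B) \<le> b * integral\<^sup>L (posterior T Q z y u k) (\<lambda>_. 1)"
      using posterior_ratio_sandwich[OF \<epsilon> D, where F="indicator B" and G="\<lambda>_. 1" and a=0 and b=1
          and k=k and y=y and u=u]
      by (auto simp: indicator_def)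
    have "a \<le> measure (posterior T Q z y u k) B \<and> measure (posterior T Q z y u k) B \<le> b"
      if z: "z \<in> space (prob_algebra M)" for z
    proof -
      note p = prob_algebraD[OF posterior_prob[OF z, of y u k]]
      show ?thesis
        using ab(2)[OF z] prob_space.prob_space[OF p(1)] B p(3) sets.Int_space_eq1[of B M]
        by (simp add: p(4))
    qed
    from this[OF z] this[OF z'] show ?thesis using ab(1) by linarith
  qed
  then have "(SUP B\<in>sets M. \<bar>measure (posterior T Q z y u k) B - measure (posterior T Q z' y u k) B\<bar>)
      \<le> (1 - \<epsilon>\<^sup>2) ^ k"
    by (intro cSUP_least) auto
  then show ?thesis by (simp add: tv_dist_def)
qed

section \<open>The predictor along typical histories\<close>

text \<open>Lists over finite types form a countable set, on which the product of the discrete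
  \<open>\<sigma>\<close>-algebras is discrete; hence policies and predicates of the history are measurable.\<close>

lemma measurable_countable_fun2:
  fixes f :: "'a::countable \<Rightarrow> 'b::countable \<Rightarrow> 'c"
  assumes "a \<in> N \<rightarrow>\<^sub>M count_space UNIV" "b \<in> N \<rightarrow>\<^sub>M count_space UNIV"
  shows "(\<lambda>x. f (a x) (b x)) \<in> N \<rightarrow>\<^sub>M count_space UNIV"
  using measurable_compose[OF measurable_Pair[OF assms], of "case_prod f" "count_space UNIV"]
  by (simp add: pair_measure_countable)

definition history_step :: "('y, 'u) policy \<Rightarrow> nat \<Rightarrow> 'x \<times> 'y list \<times> 'u list \<Rightarrow>
    ('x \<times> 'y list \<times> 'u list) measure" where
  "history_step \<gamma> n h =
     T (fst h, \<gamma> n (fst (snd h)) (snd (snd h))) \<bind> (\<lambda>x'. Q x' \<bind> (\<lambda>y'.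
       return (history_space M)
         (x', fst (snd h) @ [y'], snd (snd h) @ [\<gamma> n (fst (snd h)) (snd (snd h))])))"

lemma history_law_Suc: "history_law M T Q z0 \<gamma> (Suc n) = history_law M T Q z0 \<gamma> n \<bind> history_step \<gamma> n"
  by (simp add: history_step_def[abs_def] case_prod_beta' Let_def)

lemma measurable_history_append:
  "(\<lambda>((h, x'), y'). return (history_space M)
     (x', fst (snd h) @ [y'], snd (snd h) @ [\<gamma> n (fst (snd h)) (snd (snd h))]))
   \<in> (history_space M \<Otimes>\<^sub>M M) \<Otimes>\<^sub>M count_space UNIV \<rightarrow>\<^sub>M prob_algebra (history_space M)"
  for \<gamma> :: "('y, 'u) policy"
proof -
  have [measurable]: "(\<lambda>w. fst (snd (fst (fst w))) @ [snd w])
      \<in> (history_space M \<Otimes>\<^sub>M M) \<Otimes>\<^sub>M count_space UNIV \<rightarrow>\<^sub>M count_space (UNIV :: 'y list set)"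
    by (rule measurable_countable_fun2[where f="\<lambda>ys y. ys @ [y]"]) measurable
  have [measurable]: "(\<lambda>w. snd (snd (fst (fst w))) @
        [\<gamma> n (fst (snd (fst (fst w)))) (snd (snd (fst (fst w))))])
      \<in> (history_space M \<Otimes>\<^sub>M M) \<Otimes>\<^sub>M count_space (UNIV :: 'y set) \<rightarrow>\<^sub>M count_space (UNIV :: 'u list set)"
    by (rule measurable_countable_fun2[where f="\<lambda>us ys. us @ [\<gamma> n ys us]"]) measurable
  show ?thesis unfolding case_prod_beta' by measurable
qed

lemma measurable_history_observe:
  "(\<lambda>(h, x'). Q x' \<bind> (\<lambda>y'. return (history_space M)
     (x', fst (snd h) @ [y'], snd (snd h) @ [\<gamma> n (fst (snd h)) (snd (snd h))])))
   \<in> history_space M \<Otimes>\<^sub>M M \<rightarrow>\<^sub>M prob_algebra (history_space M)"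
  for \<gamma> :: "('y, 'u) policy"
  unfolding case_prod_beta'
proof (rule measurable_bind_prob_space2)
  show "(\<lambda>w. Q (snd w)) \<in> history_space M \<Otimes>\<^sub>M M \<rightarrow>\<^sub>M prob_algebra (count_space UNIV)"
    using measurable_compose[OF measurable_snd Q_kernel] .
qed (use measurable_history_append in \<open>simp add: case_prod_beta'\<close>)

lemma history_step_kernel:
  "history_step \<gamma> n \<in> history_space M \<rightarrow>\<^sub>M prob_algebra (history_space M)"
  unfolding history_step_def[abs_def]
proof (rule measurable_bind_prob_space2[where N=M])
  have [measurable]: "(\<lambda>h. \<gamma> n (fst (snd h)) (snd (snd h))) \<in> history_space M \<rightarrow>\<^sub>M count_space UNIV"
    by (rule measurable_countable_fun2[where f="\<gamma> n"]) measurable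
  show "(\<lambda>h. T (fst h, \<gamma> n (fst (snd h)) (snd (snd h)))) \<in> history_space M \<rightarrow>\<^sub>M prob_algebra M"
    by (rule measurable_compose[OF _ T_kernel]) measurable
qed (rule measurable_history_observe)

lemma history_law_prob:
  assumes "z0 \<in> space (prob_algebra M)"
  shows "history_law M T Q z0 \<gamma> n \<in> space (prob_algebra (history_space M))"
proof (induction n)
  case 0
  have "(\<lambda>x. Q x \<bind> (\<lambda>y. return (history_space M) (x, [y], []))) \<in> M \<rightarrow>\<^sub>M prob_algebra (history_space M)"
    by (rule measurable_bind_prob_space2[OF Q_kernel]) measurable
  from prob_bind[OF assms this] show ?case by simp
next
  case (Suc n)
  then show ?case unfolding history_law_Suc by (rule prob_bind[OF _ history_step_kernel])
qed

lemma pred_history: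
  fixes R :: "'y list \<Rightarrow> 'u list \<Rightarrow> bool"
  shows "Measurable.pred (history_space M) (\<lambda>h. R (fst (snd h)) (snd (snd h)))"
  by (rule measurable_countable_fun2[where f=R]) measurable

lemma AE_history_step:
  fixes R :: "'y list \<Rightarrow> 'u list \<Rightarrow> bool"
  assumes h: "h \<in> space (history_space M)"
    and R: "\<And>y. R (fst (snd h) @ [y]) (snd (snd h) @ [\<gamma> n (fst (snd h)) (snd (snd h))])"
  shows "AE h' in history_step \<gamma> n h. R (fst (snd h')) (snd (snd h'))"
proof -
  let ?r = "\<lambda>x' y'. return (history_space M)
    (x', fst (snd h) @ [y'], snd (snd h) @ [\<gamma> n (fst (snd h)) (snd (snd h))])"
  let ?T = "T (fst h, \<gamma> n (fst (snd h)) (snd (snd h)))"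
  have x: "fst h \<in> space M" using h by (auto simp: space_pair_measure)
  note Tx = prob_kernelD[OF T_action_kernel x, of "\<gamma> n (fst (snd h)) (snd (snd h))"]
  have k1: "(\<lambda>x'. Q x' \<bind> ?r x') \<in> ?T \<rightarrow>\<^sub>M subprob_algebra (history_space M)"
    using measurable_compose[OF measurable_Pair1'[OF h] measurable_history_observe[of \<gamma> n]]
      measurable_cong_sets[OF Tx(3) refl] by (auto intro: measurable_prob_algebraD)
  have k2: "?r x' \<in> Q x' \<rightarrow>\<^sub>M subprob_algebra (history_space M)" if "x' \<in> space M" for x'
  proof -
    have "(h, x') \<in> space (history_space M \<Otimes>\<^sub>M M)" using h that by (auto simp: space_pair_measure)
    from measurable_compose[OF measurable_Pair1'[OF this] measurable_history_append[of \<gamma> n]]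
    have "?r x' \<in> count_space UNIV \<rightarrow>\<^sub>M prob_algebra (history_space M)" by simp
    then show ?thesis
      using measurable_prob_algebraD measurable_cong_sets[OF prob_kernelD(3)[OF Q_kernel that] refl]
      by blast
  qed
  show ?thesis
    unfolding history_step_def AE_bind[OF k1 pred_history]
  proof (rule AE_I2)
    fix x' assume "x' \<in> space ?T"
    then have x': "x' \<in> space M" using Tx by simp
    show "AE h' in Q x' \<bind> ?r x'. R (fst (snd h')) (snd (snd h'))"
      unfolding AE_bind[OF k2[OF x'] pred_history]
      by (rule AE_I2, subst AE_return[OF _ pred_history]) (use x' R in \<open>auto simp: space_pair_measure\<close>)
  qed
qed

text \<open>An almost sure property of the recorded history is propagated by one deterministic check: the
  next entry of the action list is prescribed by the policy, the next observation is arbitrary.\<close>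

lemma AE_history_law_Suc:
  fixes R R' :: "'y list \<Rightarrow> 'u list \<Rightarrow> bool"
  assumes z0: "z0 \<in> space (prob_algebra M)"
    and R: "AE h in history_law M T Q z0 \<gamma> n. R (fst (snd h)) (snd (snd h))"
    and R': "\<And>ys us y. R ys us \<Longrightarrow> R' (ys @ [y]) (us @ [\<gamma> n ys us])"
  shows "AE h in history_law M T Q z0 \<gamma> (Suc n). R' (fst (snd h)) (snd (snd h))"
proof -
  note H = prob_algebraD[OF history_law_prob[OF z0, of \<gamma> n]]
  have k: "history_step \<gamma> n \<in> history_law M T Q z0 \<gamma> n \<rightarrow>\<^sub>M subprob_algebra (history_space M)"
    using measurable_prob_algebraD[OF history_step_kernel] measurable_cong_sets[OF H(3) refl] by blast
  show ?thesis
    unfolding history_law_Suc AE_bind[OF k pred_history]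
    using R AE_space
    by eventually_elim (rule AE_history_step, use H R' in auto)
qed

lemma AE_history_length:
  assumes z0: "z0 \<in> space (prob_algebra M)"
  shows "AE h in history_law M T Q z0 \<gamma> n. length (fst (snd h)) = Suc n \<and> length (snd (snd h)) = n"
proof (induction n)
  case 0
  let ?r = "\<lambda>x y. return (history_space M) (x, [y], [] :: 'u list)"
  have k1: "(\<lambda>x. Q x \<bind> ?r x) \<in> z0 \<rightarrow>\<^sub>M subprob_algebra (history_space M)"
  proof -
    have "(\<lambda>x. Q x \<bind> ?r x) \<in> M \<rightarrow>\<^sub>M prob_algebra (history_space M)"
      by (rule measurable_bind_prob_space2[OF Q_kernel]) measurable
    then show ?thesis
      using measurable_prob_algebraD measurable_cong_sets[OF prob_algebraD(3)[OF z0] refl] by blast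
  qed
  have k2: "?r x \<in> Q x \<rightarrow>\<^sub>M subprob_algebra (history_space M)" if "x \<in> space M" for x
  proof -
    have "?r x \<in> count_space UNIV \<rightarrow>\<^sub>M prob_algebra (history_space M)"
      using that by measurable
    then show ?thesis
      using measurable_prob_algebraD measurable_cong_sets[OF prob_kernelD(3)[OF Q_kernel that] refl]
      by blast
  qed
  note pr = pred_history[of "\<lambda>ys us. length ys = Suc 0 \<and> length us = 0"]
  show ?case
    unfolding history_law.simps(1) AE_bind[OF k1 pr]
  proof (rule AE_I2)
    fix x assume "x \<in> space z0"
    then have x: "x \<in> space M" using prob_algebraD[OF z0] by simp
    show "AE h in Q x \<bind> ?r x. length (fst (snd h)) = Suc 0 \<and> length (snd (snd h)) = 0"
      unfolding AE_bind[OF k2[OF x] pr]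
      by (rule AE_I2, subst AE_return[OF _ pr]) (use x in \<open>auto simp: space_pair_measure\<close>)
  qed
next
  case (Suc n)
  then show ?case by (rule AE_history_law_Suc[OF z0]) auto
qed

text \<open>The event on which the predictor at time \<open>length us\<close> conditions. The list of observations
  recorded at that time already contains the current one, which \<open>butlast\<close> drops.\<close>

definition past_event :: "'y list \<Rightarrow> 'u list \<Rightarrow> ('x \<times> 'y list \<times> 'u list) set" where
  "past_event ys us = {h \<in> space (history_space M). butlast (fst (snd h)) = ys \<and> snd (snd h) = us}"

text \<open>At \<open>k = 0\<close> the history lies in its own past event, and outside the countable union of
  the null events of this kind. Later steps only append to the lists, so the first \<open>t\<close> entries stay
  the same; the lengths are carried along to know this.\<close>

lemma AE_past_event_pos:
  assumes z0: "z0 \<in> space (prob_algebra M)"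
  shows "AE h in history_law M T Q z0 \<gamma> (t + k).
    length (fst (snd h)) = Suc (t + k) \<and> length (snd (snd h)) = t + k \<and>
    emeasure (history_law M T Q z0 \<gamma> t) (past_event (take t (fst (snd h))) (take t (snd (snd h)))) \<noteq> 0"
proof (induction k)
  case 0
  let ?H = "history_law M T Q z0 \<gamma> t"
  note H = prob_algebraD[OF history_law_prob[OF z0, of \<gamma> t]]
  have ev: "past_event ys us \<in> sets ?H" for ys us
    using pred_history[of "\<lambda>ys' us'. butlast ys' = ys \<and> us' = us"] H(3)
    by (simp add: past_event_def pred_def)
  have "AE h in ?H. emeasure ?H (past_event ys us) = 0 \<longrightarrow> h \<notin> past_event ys us" for ys us
  proof (cases "emeasure ?H (past_event ys us) = 0")
    case True
    then have "past_event ys us \<in> null_sets ?H" using ev by auto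
    then show ?thesis by (rule AE_not_in[THEN AE_mp]) auto
  qed auto
  then have "AE h in ?H. \<forall>w. emeasure ?H (past_event (fst w) (snd w)) = 0 \<longrightarrow>
      h \<notin> past_event (fst w) (snd w)"
    by (subst AE_all_countable) auto
  with AE_history_length[OF z0, where \<gamma>=\<gamma> and n=t] AE_space[of ?H] show ?case
    unfolding add_0_right
  proof eventually_elim
    case (elim h)
    then have "h \<in> past_event (take t (fst (snd h))) (take t (snd (snd h)))"
      using H(4) by (auto simp: past_event_def butlast_conv_take)
    then show ?case using elim by (metis fst_conv snd_conv)
  qed
next
  case (Suc k)
  show ?case
    unfolding add_Suc_right by (rule AE_history_law_Suc[OF z0 Suc]) auto
qed

lemma predictor_prob:
  assumes z0: "z0 \<in> space (prob_algebra M)"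
    and pos: "emeasure (history_law M T Q z0 \<gamma> t) (past_event ys us) \<noteq> 0"
  shows "predictor M T Q z0 \<gamma> t ys us \<in> space (prob_algebra M)"
proof -
  let ?H = "history_law M T Q z0 \<gamma> t"
  note H = prob_algebraD[OF history_law_prob[OF z0, of \<gamma> t]]
  have "emeasure ?H (past_event ys us) \<noteq> \<infinity>"
    using finite_measure.emeasure_finite[OF H(2)] by simp
  then have "prob_space (uniform_measure ?H (past_event ys us))"
    using pos by (intro prob_space_uniform_measure)
  moreover have "fst \<in> uniform_measure ?H (past_event ys us) \<rightarrow>\<^sub>M M"
    using H(3) by (simp cong: measurable_cong_sets)
  ultimately show ?thesis
    unfolding predictor_def past_event_def[symmetric] space_prob_algebra
    by (auto intro: prob_space.prob_space_distr)
qed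

lemma filter_gap_le:
  assumes \<epsilon>: "0 < \<epsilon>" and D: "\<And>u. dominated_kernel M \<epsilon> (m u) (\<lambda>x. T (x, u))"
    and z0: "z0 \<in> space (prob_algebra M)" and zs: "zs \<in> space (prob_algebra M)"
  shows "filter_gap M T Q z0 zs t N \<le> ennreal (2 * (1 - \<epsilon>\<^sup>2) ^ N)"
  unfolding filter_gap_def
proof (rule SUP_least)
  fix \<gamma> :: "('y, 'u) policy"
  let ?H = "history_law M T Q z0 \<gamma> (t + N)"
  let ?tv = "\<lambda>(x, ys, us). ennreal (tv_dist M
            (posterior T Q (predictor M T Q z0 \<gamma> t (take t ys) (take t us))
               (\<lambda>i. ys ! (t + i)) (\<lambda>i. us ! (t + i)) N)
            (posterior T Q zs (\<lambda>i. ys ! (t + i)) (\<lambda>i. us ! (t + i)) N))"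
  have "(\<integral>\<^sup>+h. ?tv h \<partial>?H) \<le> (\<integral>\<^sup>+h. ennreal (2 * (1 - \<epsilon>\<^sup>2) ^ N) \<partial>?H)"
  proof (rule nn_integral_mono_AE, use AE_past_event_pos[OF z0, where \<gamma>=\<gamma> and t=t and k=N] in eventually_elim)
    case (elim h)
    then show ?case
      by (auto simp: case_prod_beta'
          intro!: ennreal_leI posterior_tv_contraction[OF \<epsilon> D _ zs] predictor_prob[OF z0])
  qed
  also have "\<dots> = ennreal (2 * (1 - \<epsilon>\<^sup>2) ^ N)"
    using prob_space.emeasure_space_1[OF prob_algebraD(1)[OF history_law_prob[OF z0]]] by simp
  finally show "(\<integral>\<^sup>+h. ?tv h \<partial>?H) \<le> ennreal (2 * (1 - \<epsilon>\<^sup>2) ^ N)" .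
qed

end

section \<open>Geometric filter stability\<close>

theorem lemma7:
  fixes M :: "'x measure"
    and T :: "'x \<times> 'u::finite \<Rightarrow> 'x measure"
    and Q :: "'x \<Rightarrow> 'y::finite measure"
    and z0 zs :: "'x measure"
  assumes "standard_borel M"
    and "T \<in> M \<Otimes>\<^sub>M count_space UNIV \<rightarrow>\<^sub>M prob_algebra M"
    and "Q \<in> M \<rightarrow>\<^sub>M prob_algebra (count_space UNIV)"
    and "\<exists>\<epsilon>>0. \<forall>x\<in>space M. \<forall>y. measure (Q x) {y} \<ge> \<epsilon>"
    and "\<And>u. mixing_kernel M (\<lambda>x. T (x, u))"
    and "z0 \<in> space (prob_algebra M)"
    and "zs \<in> space (prob_algebra M)"
  shows "\<exists>r K :: real. 0 \<le> r \<and> r < 1 \<and>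
           (\<forall>t N. N \<ge> 1 \<longrightarrow> filter_gap M T Q z0 zs t N \<le> ennreal (r ^ (N - 1) * K))"
proof -
  interpret positive_filter M T Q
    using assms(2-4) by unfold_locales (auto intro: less_le_trans)
  have "\<forall>u. \<exists>e m. 0 < e \<and> e \<le> 1 \<and> dominated_kernel M e m (\<lambda>x. T (x, u))"
    using assms(5) unfolding mixing_kernel_def dominated_kernel_def by blast
  then obtain e m where em: "\<And>u. 0 < e u \<and> e u \<le> 1 \<and> dominated_kernel M (e u) (m u) (\<lambda>x. T (x, u))"
    by metis
  define \<epsilon> where "\<epsilon> = Min (range e)"
  have \<epsilon>: "0 < \<epsilon>" "\<epsilon> \<le> 1" and le: "\<epsilon> \<le> e u" for u
    using em by (auto simp: \<epsilon>_def Min_le_iff intro: exI[of _ undefined])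
  have D: "dominated_kernel M \<epsilon> (m u) (\<lambda>x. T (x, u))" for u
    using dominated_kernel_mono[OF _ \<epsilon>(1) le[of u]] em by blast
  have r: "0 \<le> 1 - \<epsilon>\<^sup>2" "1 - \<epsilon>\<^sup>2 < 1" using \<epsilon> by (auto simp: power_le_one)
  have "filter_gap M T Q z0 zs t N \<le> ennreal ((1 - \<epsilon>\<^sup>2) ^ (N - 1) * 2)" for t N
  proof -
    have "(1 - \<epsilon>\<^sup>2) ^ N \<le> (1 - \<epsilon>\<^sup>2) ^ (N - 1)" using r by (intro power_decreasing) auto
    then have "ennreal (2 * (1 - \<epsilon>\<^sup>2) ^ N) \<le> ennreal ((1 - \<epsilon>\<^sup>2) ^ (N - 1) * 2)"
      by (intro ennreal_leI) simp
    with filter_gap_le[OF \<epsilon>(1) D assms(6,7), of t N] show ?thesis by (rule order_trans)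
  qed
  then show ?thesis using r by blast
qed

end
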